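(* Let $V$ be a finite dimensional real vector space, $B\subseteq V$ a compact convex polyhedral $0$-neighborhood with associated asymmetric polyhedral norm $\nu$, and let $\widehat V$ be the bordification of $V$ (regarded as the set of normalized horofunctions) with respect to $\delta(u,v)=\nu(u-v)$. Put $V_K=V$ and $V_L=V/H_L$ for $L\in\Sigma$. Then there is a $V$-equivariant bijection $$\Phi:\widehat V\longrightarrow \bigsqcup\{V_L\mid L\in\Sigma\cup\{K\}\}$$ given by $$\Phi[v\longmapsto \nu(p-v)-\nu(p)]=p\in V_K \qquad (p\in V)$$ and $$\Phi[v\longmapsto \nu_L(p-v)-\nu_L(p)]=p+H_L\in V_L\qquad (p\in V,\ L\in\Sigma).$$ The restriction of $\Phi^{-1}$ to each of the vector spaces $V_L$, $L\in\Sigma\cup\{K\}$ (with its standard vector space topology), is a homeomorphism onto its image in $\widehat V$.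
   Context: $V$ is a finite dimensional real vector space with dual $V^\vee$, endowed with a Euclidean norm $\|\cdot\|$, and $0$ is the base point. $B\subseteq V$ is a compact convex polyhedral neighborhood of $0$ with codimension-1 faces $A_0,\dots,A_m$, and $K=\{0,\dots,m\}$. For each $j\in K$, $\xi_j\in V^\vee$ is the unique linear functional with $A_j=\{v\in B\mid \xi_j(v)=1\}$; thus $B=\{u\in V\mid \xi_j(u)\le 1\text{ for all }j\in K\}$, and the asymmetric norm with unit ball $B$ is $\nu(u)=\max\{\xi_0(u),\dots,\xi_m(u)\}$. Put $\delta(u,v)=\nu(u-v)$. A nonempty subset $L\subseteq K$ is a dual face if there is $v\in V$ with $\nu(v)=1$ and $L=\{k\in K\mid \xi_k(v)=1\}$; $\Sigma$ is the set of all dual faces. For nonempty $L\subseteq K$: $\nu_L(u)=\max\{\xi_\ell(u)\mid \ell\in L\}$ and $H_L=\{u\in V\mid \xi_k(u)=\xi_\ell(u)\text{ for all }k,\ell\in L\}$. The bordification $\widehat V$ is the closure of $\{u\mapsto\delta(p,u)-\delta(p,0)\mid p\in V\}$ in the space of continuous functions $f:V\to\mathbb R$ with $f(0)=0$, in the topology of uniform convergence on bounded sets. Its elements are the normalized horofunctions; they are exactly the functions appearing in the definition of $\Phi$. The group $V$ acts on $\widehat V$ by $(\tau_w\varphi)(x)=\varphi(x-w)-\varphi(-w)$ and on each $V_L$ by translations. The disjoint union is formal (different $L$ may have the same $H_L$). *)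

theory Defs
  imports "HOL-Analysis.Analysis"
begin

section \<open>Polyhedral asymmetric norms\<close>

text \<open>
  The dual space is rendered by linear maps \<open>\<xi> j :: 'a \<Rightarrow> real\<close>, with \<open>j\<close> ranging over a finite
  nonempty index set \<open>K\<close>.
\<close>

definition nu :: "(nat \<Rightarrow> 'a \<Rightarrow> real) \<Rightarrow> nat set \<Rightarrow> 'a \<Rightarrow> real" where
  "nu \<xi> L u = Max ((\<lambda>l. \<xi> l u) ` L)"

definition delta :: "(nat \<Rightarrow> 'a::real_vector \<Rightarrow> real) \<Rightarrow> nat set \<Rightarrow> 'a \<Rightarrow> 'a \<Rightarrow> real" where
  "delta \<xi> K u v = nu \<xi> K (u - v)"

definition dual_faces :: "(nat \<Rightarrow> 'a \<Rightarrow> real) \<Rightarrow> nat set \<Rightarrow> nat set set" where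
  "dual_faces \<xi> K =
     {L. L \<noteq> {} \<and> L \<subseteq> K \<and> (\<exists>v. nu \<xi> K v = 1 \<and> L = {k \<in> K. \<xi> k v = 1})}"

definition eq_subspace :: "(nat \<Rightarrow> 'a \<Rightarrow> real) \<Rightarrow> nat set \<Rightarrow> 'a set" where
  "eq_subspace \<xi> L = {u. \<forall>k\<in>L. \<forall>l\<in>L. \<xi> k u = \<xi> l u}"

section \<open>The bordification\<close>

definition based_continuous :: "('a::real_normed_vector \<Rightarrow> real) set" where
  "based_continuous = {f. continuous_on UNIV f \<and> f 0 = 0}"

definition bounded_convergence_topology :: "('a::real_normed_vector \<Rightarrow> real) topology" where
  "bounded_convergence_topology = topology (\<lambda>U. U \<subseteq> based_continuous \<and>
     (\<forall>f\<in>U. \<exists>S e. bounded S \<and> 0 < e \<and>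
        {g \<in> based_continuous. \<forall>x\<in>S. \<bar>g x - f x\<bar> < e} \<subseteq> U))"

lemma openin_bounded_convergence_topology:
  "openin bounded_convergence_topology U \<longleftrightarrow> U \<subseteq> based_continuous \<and>
     (\<forall>f\<in>U. \<exists>S e. bounded S \<and> 0 < e \<and>
        {g \<in> based_continuous. \<forall>x\<in>S. \<bar>g x - f x\<bar> < e} \<subseteq> U)"
proof -
  let ?N = "\<lambda>(f::'a \<Rightarrow> real) S e. {g \<in> based_continuous. \<forall>x\<in>S. \<bar>g x - f x\<bar> < e}"
  let ?P = "\<lambda>U. U \<subseteq> based_continuous \<and> (\<forall>f\<in>U. \<exists>S e. bounded S \<and> 0 < e \<and> ?N f S e \<subseteq> U)"
  have "istopology ?P"
    unfolding istopology_def
  proof (intro conjI allI impI)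
    fix U W assume U: "?P U" and W: "?P W"
    show "U \<inter> W \<subseteq> based_continuous" using U by blast
    show "\<forall>f\<in>U \<inter> W. \<exists>S e. bounded S \<and> 0 < e \<and> ?N f S e \<subseteq> U \<inter> W"
    proof
      fix f assume "f \<in> U \<inter> W"
      then obtain S e T d where "bounded S" "0 < e" "?N f S e \<subseteq> U"
        and "bounded T" "0 < d" "?N f T d \<subseteq> W"
        using U W by (meson IntD1 IntD2)
      moreover have "?N f (S \<union> T) (min e d) \<subseteq> ?N f S e \<inter> ?N f T d" by auto
      ultimately show "\<exists>S e. bounded S \<and> 0 < e \<and> ?N f S e \<subseteq> U \<inter> W"
        by (intro exI[of _ "S \<union> T"] exI[of _ "min e d"]) auto
    qed
  next
    fix \<U> assume P: "\<forall>U\<in>\<U>. ?P U"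
    show "\<Union>\<U> \<subseteq> based_continuous" using P by blast
    show "\<forall>f\<in>\<Union>\<U>. \<exists>S e. bounded S \<and> 0 < e \<and> ?N f S e \<subseteq> \<Union>\<U>"
      using P by (meson UnionE Union_upper subset_trans)
  qed
  then show ?thesis
    by (simp add: bounded_convergence_topology_def topology_inverse')
qed

lemma topspace_bounded_convergence_topology [simp]:
  "topspace bounded_convergence_topology = based_continuous"
proof -
  have "openin bounded_convergence_topology (based_continuous :: ('a \<Rightarrow> real) set)"
    unfolding openin_bounded_convergence_topology
    by (auto intro!: exI[of _ "{}"] exI[of _ "1::real"])
  then show ?thesis
    by (metis openin_bounded_convergence_topology openin_subset openin_topspace subset_antisym)
qed

lemma limitin_bounded_convergence_topology:
  "limitin bounded_convergence_topology f l F \<longleftrightarrow>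
     l \<in> based_continuous \<and> eventually (\<lambda>x. f x \<in> based_continuous) F \<and>
     (\<forall>S. bounded S \<longrightarrow> uniform_limit S f l F)"
proof (intro iffI conjI allI impI)
  assume lim: "limitin bounded_convergence_topology f l F"
  show l: "l \<in> based_continuous" using lim by (simp add: limitin_def)
  have "openin bounded_convergence_topology (based_continuous :: ('a \<Rightarrow> real) set)"
    by (metis openin_topspace topspace_bounded_convergence_topology)
  then show "eventually (\<lambda>x. f x \<in> based_continuous) F"
    using lim l by (auto simp: limitin_def)
  fix S :: "'a set" assume S: "bounded S"
  show "uniform_limit S f l F"
  proof (rule uniform_limitI)
    fix e :: real assume e: "0 < e"
    define U where "U = {g \<in> based_continuous. \<exists>d>0. \<forall>x\<in>S. \<bar>g x - l x\<bar> \<le> e - d}"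
    have "openin bounded_convergence_topology U"
      unfolding openin_bounded_convergence_topology
    proof (intro conjI ballI)
      show "U \<subseteq> based_continuous" by (auto simp: U_def)
      fix g assume "g \<in> U"
      then obtain d where d: "d > 0" "\<forall>x\<in>S. \<bar>g x - l x\<bar> \<le> e - d" by (auto simp: U_def)
      have "{h \<in> based_continuous. \<forall>x\<in>S. \<bar>h x - g x\<bar> < d/2} \<subseteq> U"
      proof
        fix h assume "h \<in> {h \<in> based_continuous. \<forall>x\<in>S. \<bar>h x - g x\<bar> < d/2}"
        then have h: "h \<in> based_continuous" "\<And>x. x \<in> S \<Longrightarrow> \<bar>h x - g x\<bar> < d/2" by auto
        have "\<forall>x\<in>S. \<bar>h x - l x\<bar> \<le> e - d/2"
        proof
          fix x assume "x \<in> S"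
          then have "\<bar>h x - g x\<bar> < d/2" "\<bar>g x - l x\<bar> \<le> e - d" using h(2) d(2) by blast+
          then show "\<bar>h x - l x\<bar> \<le> e - d/2" by argo
        qed
        then show "h \<in> U" using h(1) d(1) by (auto simp: U_def intro!: exI[of _ "d/2"])
      qed
      then show "\<exists>S e. bounded S \<and> 0 < e \<and>
          {h \<in> based_continuous. \<forall>x\<in>S. \<bar>h x - g x\<bar> < e} \<subseteq> U"
        using S d(1) by (intro exI[of _ S] exI[of _ "d/2"]) auto
    qed
    moreover have "l \<in> U" using l e by (auto simp: U_def intro!: exI[of _ e])
    ultimately have "eventually (\<lambda>x. f x \<in> U) F" using lim by (simp add: limitin_def)
    then show "\<forall>\<^sub>F n in F. \<forall>x\<in>S. dist (f n x) (l x) < e"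
      by eventually_elim (force simp: U_def dist_real_def)
  qed
next
  assume R: "l \<in> based_continuous \<and> eventually (\<lambda>x. f x \<in> based_continuous) F \<and>
     (\<forall>S. bounded S \<longrightarrow> uniform_limit S f l F)"
  show "limitin bounded_convergence_topology f l F"
    unfolding limitin_def
  proof (intro conjI allI impI)
    show "l \<in> topspace bounded_convergence_topology" using R by simp
    fix U :: "('a \<Rightarrow> real) set" assume "openin bounded_convergence_topology U \<and> l \<in> U"
    then obtain S e where Se: "bounded S" "0 < e"
      and sub: "{g \<in> based_continuous. \<forall>x\<in>S. \<bar>g x - l x\<bar> < e} \<subseteq> U"
      unfolding openin_bounded_convergence_topology by blast
    have "\<forall>\<^sub>F n in F. \<forall>x\<in>S. dist (f n x) (l x) < e"
      using R Se by (blast intro: uniform_limitD)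
    moreover have "\<forall>\<^sub>F n in F. f n \<in> based_continuous" using R by blast
    ultimately show "\<forall>\<^sub>F n in F. f n \<in> U"
      by eventually_elim (use sub in \<open>auto simp: dist_real_def\<close>)
  qed
qed

definition bordification ::
    "(nat \<Rightarrow> 'a::real_normed_vector \<Rightarrow> real) \<Rightarrow> nat set \<Rightarrow> ('a \<Rightarrow> real) set" where
  "bordification \<xi> K =
     bounded_convergence_topology closure_of range (\<lambda>p u. delta \<xi> K p u - delta \<xi> K p 0)"

definition bordification_topology ::
    "(nat \<Rightarrow> 'a::real_normed_vector \<Rightarrow> real) \<Rightarrow> nat set \<Rightarrow> ('a \<Rightarrow> real) topology" where
  "bordification_topology \<xi> K = subtopology bounded_convergence_topology (bordification \<xi> K)"

definition horo_translate :: "'a::real_vector \<Rightarrow> ('a \<Rightarrow> real) \<Rightarrow> 'a \<Rightarrow> real" where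
  "horo_translate w \<phi> x = \<phi> (x - w) - \<phi> (- w)"

section \<open>Quotient spaces and the stratified space\<close>

definition coset :: "'a::real_vector set \<Rightarrow> 'a \<Rightarrow> 'a set" where
  "coset H p = (\<lambda>h. p + h) ` H"

definition quotient_space :: "'a::real_vector set \<Rightarrow> 'a set set" where
  "quotient_space H = range (coset H)"

text \<open>
  For a subspace \<open>H\<close> of a finite dimensional space, the quotient topology is the standard
  vector space topology of the quotient.
\<close>

definition quotient_topology :: "'a::real_normed_vector set \<Rightarrow> 'a set topology" where
  "quotient_topology H = topology (\<lambda>U. U \<subseteq> quotient_space H \<and> open (coset H -` U))"

lemma openin_quotient_topology:
  "openin (quotient_topology H) U \<longleftrightarrow> U \<subseteq> quotient_space H \<and> open (coset H -` U)"
proof -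
  have "istopology (\<lambda>U. U \<subseteq> quotient_space H \<and> open (coset H -` U))"
    by (auto simp: istopology_def vimage_Union)
  then show ?thesis by (simp add: quotient_topology_def topology_inverse')
qed

lemma topspace_quotient_topology [simp]: "topspace (quotient_topology H) = quotient_space H"
proof -
  have "coset H -` quotient_space H = UNIV" by (auto simp: quotient_space_def)
  then have "openin (quotient_topology H) (quotient_space H)"
    by (simp add: openin_quotient_topology)
  then show ?thesis
    by (metis openin_quotient_topology openin_subset openin_topspace subset_antisym)
qed

lemma quotient_map_coset: "quotient_map euclidean (quotient_topology H) (coset H)"
  by (auto simp: quotient_map_def openin_quotient_topology quotient_space_def vimage_def)

text \<open>
  The formal disjoint union of \<open>V\<^sub>K = V\<close> and the quotients \<open>V\<^sub>L\<close> by \<open>eq_subspace \<xi> L\<close>, for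
  \<open>L\<close> a dual face: \<open>Inl p\<close> is the point \<open>p\<close> of \<open>V\<^sub>K\<close>, and \<open>Inr (L, c)\<close> is the point \<open>c\<close> of \<open>V\<^sub>L\<close>.
  The separate tag for \<open>V\<^sub>K\<close> creates no second copy of an index: when the unit ball is bounded,
  \<open>K\<close> is not a dual face.
\<close>

definition strata ::
    "(nat \<Rightarrow> 'a::real_vector \<Rightarrow> real) \<Rightarrow> nat set \<Rightarrow> ('a + nat set \<times> 'a set) set" where
  "strata \<xi> K =
     range Inl \<union> Inr ` (SIGMA L : dual_faces \<xi> K. quotient_space (eq_subspace \<xi> L))"

fun strata_translate ::
    "'a::real_vector \<Rightarrow> 'a + nat set \<times> 'a set \<Rightarrow> 'a + nat set \<times> 'a set" where
  "strata_translate w (Inl p) = Inl (w + p)"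
| "strata_translate w (Inr (L, c)) = Inr (L, (\<lambda>x. w + x) ` c)"

end

theory Submission
  imports Defs
begin

text \<open>
  Up to a subsequence, each number \<open>\<xi> j p\<^sub>n - \<nu> p\<^sub>n \<le> 0\<close> converges in \<open>[-\<infinity>, 0]\<close>; let \<open>L\<close> be the set
  of indices with finite limit. The differences of the \<open>\<xi> l p\<^sub>n\<close> with \<open>l \<in> L\<close> stay bounded, so
  \<open>p\<^sub>n = h\<^sub>n + y\<^sub>n\<close> with \<open>h\<^sub>n \<in> H\<^sub>L\<close> and \<open>y\<^sub>n\<close> converging to some \<open>y\<close>. If \<open>L \<noteq> K\<close>, then for large \<open>n\<close> a
  positive multiple of \<open>h\<^sub>n\<close> witnesses that \<open>L\<close> is a dual face, and the limit horofunction is the one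
  of \<open>y + H\<^sub>L\<close>. Conversely, moving \<open>p\<close> along a vector \<open>v\<close> that defines a dual face \<open>L\<close> yields
  functions that agree with the horofunction of \<open>p + H\<^sub>L\<close> on larger and larger bounded sets.

  For injectivity and the continuity of the inverse, choose \<open>e j\<close> in the facet \<open>A j\<close> but in no other
  facet. For large \<open>t\<close>, the value of a horofunction at \<open>- t e j\<close> detects whether \<open>j \<in> L\<close>, and if so
  it equals \<open>t + \<xi> j p - \<nu>\<^sub>L p\<close>. These finitely many values determine \<open>p + H\<^sub>L\<close>, with a Lipschitz
  estimate.
\<close>

section \<open>Maxima, subsequences and neighbourhoods\<close>

lemma nu_ge:
  assumes "finite L" "l \<in> L"
  shows "\<xi> l u \<le> nu \<xi> L u"
  unfolding nu_def using assms by (intro Max_ge) auto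

lemma nu_attained:
  assumes "finite L" "L \<noteq> {}"
  obtains l where "l \<in> L" "nu \<xi> L u = \<xi> l u"
proof -
  have "Max ((\<lambda>l. \<xi> l u) ` L) \<in> (\<lambda>l. \<xi> l u) ` L"
    using assms by (intro Max_in) auto
  then show ?thesis using that by (auto simp: nu_def)
qed

lemma nu_eqI:
  assumes "finite L" "l \<in> L" "\<xi> l u = c" "\<And>k. k \<in> L \<Longrightarrow> \<xi> k u \<le> c"
  shows "nu \<xi> L u = c"
  unfolding nu_def using assms by (intro Max_eqI) auto

text \<open>Once the indices outside \<open>L\<close> are dominated by those in \<open>L\<close>,
  they drop out of the maximum. This turns the norm into \<open>nu \<xi> L\<close> far away from the
  origin.\<close>

lemma nu_restrict:
  assumes "finite K" "L \<subseteq> K" "L \<noteq> {}"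
    and "\<And>k l. k \<in> K - L \<Longrightarrow> l \<in> L \<Longrightarrow> \<xi> k u \<le> \<xi> l u"
  shows "nu \<xi> K u = nu \<xi> L u"
proof -
  have "finite L" using assms finite_subset by blast
  then obtain l where l: "l \<in> L" "nu \<xi> L u = \<xi> l u" using assms(3) nu_attained by metis
  show ?thesis
  proof (rule nu_eqI[OF assms(1)])
    show "l \<in> K" "\<xi> l u = nu \<xi> L u" using l assms by auto
    fix k assume "k \<in> K"
    then show "\<xi> k u \<le> nu \<xi> L u"
      using assms(4)[of k l] l nu_ge[OF \<open>finite L\<close>, of k \<xi> u] by (cases "k \<in> L") auto
  qed
qed

lemma eventually_le_mult_at_top:
  fixes M c :: real
  assumes "c > 0"
  shows "\<forall>\<^sub>F t in at_top. M \<le> t * c"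
proof -
  have "filterlim (\<lambda>t. t * c) at_top at_top"
    using assms filterlim_at_top_mult_tendsto_pos[OF tendsto_const _ filterlim_ident] by blast
  then show ?thesis by (simp add: filterlim_at_top)
qed

text \<open>Complete linear orders are sequentially compact, infinite values included, so one can
  pass to a further subsequence once for each index.\<close>

lemma finite_simultaneous_convergent_subseq:
  fixes X :: "'i \<Rightarrow> nat \<Rightarrow> 'b::{complete_linorder, linorder_topology, first_countable_topology}"
  assumes "finite K"
  shows "\<exists>r::nat \<Rightarrow> nat. strict_mono r \<and> (\<forall>j\<in>K. \<exists>l. (\<lambda>n. X j (r n)) \<longlonglongrightarrow> l)"
  using assms
proof (induction K)
  case empty
  then show ?case by (auto intro: strict_mono_id)
next
  case (insert i K)
  then obtain r where r: "strict_mono (r::nat \<Rightarrow> nat)" "\<forall>j\<in>K. \<exists>l. (\<lambda>n. X j (r n)) \<longlonglongrightarrow> l" by blast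
  obtain l s where s: "strict_mono (s::nat \<Rightarrow> nat)" "((\<lambda>n. X i (r n)) \<circ> s) \<longlonglongrightarrow> l"
    using compact_complete_linorder by metis
  have "\<exists>l. (\<lambda>n. X j (r (s n))) \<longlonglongrightarrow> l" if j: "j \<in> insert i K" for j
  proof (cases "j = i")
    case True
    then show ?thesis using s(2) by (auto simp: o_def)
  next
    case False
    then obtain a where "(\<lambda>n. X j (r n)) \<longlonglongrightarrow> a" using r(2) j by auto
    from LIMSEQ_subseq_LIMSEQ[OF this s(1)] show ?thesis by (auto simp: o_def)
  qed
  then show ?case
    using strict_mono_o[OF r(1) s(1)] by (intro exI[of _ "r \<circ> s"]) (simp add: o_def)
qed

text \<open>The strict pointwise bound on \<open>S\<close> need not define an open set, because the
  supremum over \<open>S\<close> may equal \<open>e\<close>. Asking for a uniform margin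
  \<open>d\<close> gives an open set inside it.\<close>

lemma bounded_convergence_nbhd:
  fixes f :: "'a::real_normed_vector \<Rightarrow> real"
  assumes "f \<in> based_continuous" "bounded S" "0 < e"
  obtains T where "openin bounded_convergence_topology T" "f \<in> T"
    "\<And>g x. g \<in> T \<Longrightarrow> x \<in> S \<Longrightarrow> \<bar>g x - f x\<bar> < e"
proof
  define T where "T = {g \<in> based_continuous. \<exists>d>0. \<forall>x\<in>S. \<bar>g x - f x\<bar> \<le> e - d}"
  show "openin bounded_convergence_topology T"
    unfolding openin_bounded_convergence_topology
  proof (intro conjI ballI)
    show "T \<subseteq> based_continuous" by (auto simp: T_def)
    fix g assume "g \<in> T"
    then obtain d where d: "d > 0" "\<And>x. x \<in> S \<Longrightarrow> \<bar>g x - f x\<bar> \<le> e - d" by (auto simp: T_def)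
    have "h \<in> T" if h: "h \<in> based_continuous" "\<forall>x\<in>S. \<bar>h x - g x\<bar> < d/2" for h
    proof -
      have "\<bar>h x - f x\<bar> \<le> e - d/2" if "x \<in> S" for x
        using bspec[OF h(2) that] d(2)[OF that] by argo
      then show ?thesis using h(1) d(1) by (auto simp: T_def intro!: exI[of _ "d/2"])
    qed
    then show "\<exists>S e. bounded S \<and> 0 < e \<and> {h \<in> based_continuous. \<forall>x\<in>S. \<bar>h x - g x\<bar> < e} \<subseteq> T"
      using assms(2) d(1) by (intro exI[of _ S] exI[of _ "d/2"]) auto
  qed
  show "f \<in> T" using assms by (auto simp: T_def intro!: exI[of _ e])
  show "\<bar>g x - f x\<bar> < e" if "g \<in> T" "x \<in> S" for g x
    using that by (force simp: T_def)
qed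

section \<open>Horofunctions of a polyhedral norm\<close>

text \<open>The polytope enters through its bounded unit ball and the points \<open>e j\<close>. The
  latter express that no functional is redundant, which is what allows the index set of a
  horofunction to be recovered.\<close>

locale polyhedral_norm =
  fixes \<xi> :: "nat \<Rightarrow> 'a::euclidean_space \<Rightarrow> real" and K :: "nat set" and e :: "nat \<Rightarrow> 'a"
  assumes finite_K: "finite K" and K_ne: "K \<noteq> {}"
    and lin: "j \<in> K \<Longrightarrow> linear (\<xi> j)"
    and bounded_ball: "bounded {u. \<forall>k\<in>K. \<xi> k u \<le> 1}"
    and exposed: "j \<in> K \<Longrightarrow> \<xi> j (e j) = 1"
    and exposed_less: "j \<in> K \<Longrightarrow> k \<in> K \<Longrightarrow> k \<noteq> j \<Longrightarrow> \<xi> k (e j) < 1"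
begin

definition horo :: "nat set \<Rightarrow> 'a \<Rightarrow> 'a \<Rightarrow> real" where
  "horo L p v = nu \<xi> L (p - v) - nu \<xi> L p"

definition indices :: "nat set set" where
  "indices = insert K (dual_faces \<xi> K)"

section \<open>Elementary properties of the norm and of dual faces\<close>

lemma \<xi>_simps:
  assumes "j \<in> K"
  shows "\<xi> j (x + y) = \<xi> j x + \<xi> j y" "\<xi> j (x - y) = \<xi> j x - \<xi> j y"
    "\<xi> j (c *\<^sub>R x) = c * \<xi> j x" "\<xi> j 0 = 0" "\<xi> j (- x) = - \<xi> j x"
  using lin[OF assms]
  by (simp_all add: linear_add linear_diff linear_cmul linear_0 linear_neg)

lemma indices_subset: "L \<in> indices \<Longrightarrow> L \<subseteq> K"
  and indices_ne: "L \<in> indices \<Longrightarrow> L \<noteq> {}"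
  and indices_finite: "L \<in> indices \<Longrightarrow> finite L"
  using finite_K K_ne finite_subset by (auto simp: indices_def dual_faces_def)

text \<open>If every functional were nonpositive at \<open>u\<close>, the whole ray through
  \<open>u\<close> would lie in the bounded unit ball. The scaling \<open>t\<close> below produces a
  point of norm \<open>b + 1\<close>.\<close>

lemma nu_pos:
  assumes "u \<noteq> 0"
  shows "0 < nu \<xi> K u"
proof (rule ccontr)
  assume neg: "\<not> 0 < nu \<xi> K u"
  obtain b where b: "\<And>x. \<forall>k\<in>K. \<xi> k x \<le> 1 \<Longrightarrow> norm x \<le> b"
    using bounded_ball by (auto simp: bounded_iff)
  have b0: "b \<ge> 0" using b[of 0] by (simp add: \<xi>_simps)
  define t where "t = (b + 1) / norm u"
  have "t \<ge> 0" using b0 by (simp add: t_def)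
  have "\<xi> k u \<le> 0" if "k \<in> K" for k
    using neg nu_ge[OF finite_K that, of \<xi> u] by linarith
  then have "\<xi> k (t *\<^sub>R u) \<le> 1" if "k \<in> K" for k
    using that \<open>t \<ge> 0\<close> by (simp add: \<xi>_simps) (meson mult_nonneg_nonpos order_trans zero_le_one)
  then have "norm (t *\<^sub>R u) \<le> b" using b by blast
  then show False using assms \<open>t \<ge> 0\<close> b0 by (simp add: t_def)
qed

text \<open>If all functionals agree at \<open>u\<close>, their common value is the norm of
  \<open>u\<close> and its negative is the norm of \<open>-u\<close>; these cannot both be
  positive.\<close>

lemma eq_subspace_K: "eq_subspace \<xi> K = {0}"
proof -
  have "u = 0" if u: "u \<in> eq_subspace \<xi> K" for u
  proof (rule ccontr)
    assume "u \<noteq> 0"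
    obtain k where k: "k \<in> K" "nu \<xi> K u = \<xi> k u" using finite_K K_ne nu_attained by metis
    obtain l where l: "l \<in> K" "nu \<xi> K (-u) = \<xi> l (-u)" using finite_K K_ne nu_attained by metis
    have "\<xi> k u = \<xi> l u" using u k(1) l(1) unfolding eq_subspace_def by blast
    then show False
      using nu_pos[of u] nu_pos[of "-u"] \<open>u \<noteq> 0\<close> k l by (simp add: \<xi>_simps)
  qed
  then show ?thesis by (auto simp: eq_subspace_def \<xi>_simps)
qed

text \<open>This keeps the top stratum apart from the strata of the dual faces when injectivity is
  proved.\<close>

lemma K_not_dual_face: "K \<notin> dual_faces \<xi> K"
proof
  assume "K \<in> dual_faces \<xi> K"
  then obtain v where v: "nu \<xi> K v = 1" "\<And>k. k \<in> K \<Longrightarrow> \<xi> k v = 1" by (auto simp: dual_faces_def)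
  then have "v \<in> eq_subspace \<xi> K" by (simp add: eq_subspace_def)
  then have "v = 0" using eq_subspace_K by simp
  then show False using v(2) K_ne by (auto simp: \<xi>_simps)
qed

text \<open>The common level \<open>s\<close> equals \<open>nu \<xi> K h\<close>. As
  \<open>L\<close> is neither empty nor \<open>K\<close>, the functionals take different values at
  \<open>h\<close>, so \<open>h\<close> is nonzero and \<open>s\<close> is positive; dividing by
  \<open>s\<close> gives a witness on the unit sphere.\<close>

lemma dual_faceI:
  assumes L: "L \<subseteq> K" "L \<noteq> {}" "L \<noteq> K"
    and h: "\<And>l. l \<in> L \<Longrightarrow> \<xi> l h = s" "\<And>k. k \<in> K - L \<Longrightarrow> \<xi> k h < s"
  shows "L \<in> dual_faces \<xi> K"
proof -
  obtain l where l: "l \<in> L" using L by blast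
  have "nu \<xi> K h = s" using L l h by (intro nu_eqI[OF finite_K, of l]) force+
  moreover have "h \<noteq> 0" using L h l by (force simp: \<xi>_simps subset_iff)
  ultimately have s: "s > 0" using nu_pos by blast
  define v where "v = (1/s) *\<^sub>R h"
  have v1: "\<xi> l v = 1" if "l \<in> L" for l
    using that h L s by (auto simp: v_def \<xi>_simps subset_iff)
  have v2: "\<xi> k v < 1" if "k \<in> K - L" for k
    using that h L s by (auto simp: v_def \<xi>_simps subset_iff)
  have "nu \<xi> K v = 1" using L l v1 v2 by (intro nu_eqI[OF finite_K, of l]) force+
  moreover have "L = {k \<in> K. \<xi> k v = 1}" using v1 v2 L by force
  ultimately show ?thesis using L by (auto simp: dual_faces_def)
qed

lemma \<xi>_bound:
  obtains C where "C > 0" "\<And>k x. k \<in> K \<Longrightarrow> \<bar>\<xi> k x\<bar> \<le> C * norm x"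
proof -
  have "\<exists>C>0. \<forall>x. \<bar>\<xi> k x\<bar> \<le> C * norm x" if k: "k \<in> K" for k
    using linear_bounded_pos[OF lin[OF k]] by auto
  then obtain C where C: "\<And>k. k \<in> K \<Longrightarrow> C k > 0" "\<And>k x. k \<in> K \<Longrightarrow> \<bar>\<xi> k x\<bar> \<le> C k * norm x"
    by metis
  show ?thesis
  proof
    show "sum C K > 0" using C K_ne finite_K by (intro sum_pos) auto
    fix k x assume k: "k \<in> K"
    have "C k \<le> sum C K" using k finite_K C by (intro member_le_sum) (auto intro: less_imp_le)
    then show "\<bar>\<xi> k x\<bar> \<le> sum C K * norm x"
      using C(2)[OF k, of x] by (meson mult_right_mono norm_ge_zero order_trans)
  qed
qed

section \<open>Continuity and invariance of horofunctions\<close>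

lemma nu_lipschitz:
  assumes C: "\<And>k x. k \<in> K \<Longrightarrow> \<bar>\<xi> k x\<bar> \<le> C * norm x" and L: "L \<subseteq> K" "L \<noteq> {}"
  shows "\<bar>nu \<xi> L x - nu \<xi> L y\<bar> \<le> C * norm (x - y)"
proof -
  have fin: "finite L" using L finite_K finite_subset by blast
  have *: "nu \<xi> L x - nu \<xi> L y \<le> C * norm (x - y)" for x y
  proof -
    obtain l where l: "l \<in> L" "nu \<xi> L x = \<xi> l x" using fin L nu_attained by metis
    have "\<xi> l x - \<xi> l y \<le> C * norm (x - y)"
      using C[of l "x - y"] l L by (auto simp: \<xi>_simps subset_iff)
    then show ?thesis using l nu_ge[OF fin l(1), of \<xi> y] by linarith
  qed
  show ?thesis using *[of x y] *[of y x] by (simp add: norm_minus_commute)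
qed

lemma continuous_nu:
  assumes "L \<subseteq> K" "L \<noteq> {}"
  shows "continuous_on UNIV (nu \<xi> L)"
proof -
  obtain C where C: "C > 0" "\<And>k x. k \<in> K \<Longrightarrow> \<bar>\<xi> k x\<bar> \<le> C * norm x" using \<xi>_bound by blast
  have "C-lipschitz_on UNIV (nu \<xi> L)"
    using nu_lipschitz[OF C(2) assms] C(1) by (intro lipschitz_onI) (auto simp: dist_norm)
  then show ?thesis by (rule lipschitz_on_continuous_on)
qed

lemma horo_based_continuous:
  assumes "L \<in> indices"
  shows "horo L p \<in> based_continuous"
proof -
  have "continuous_on UNIV (\<lambda>v. nu \<xi> L (p - v))"
    using continuous_nu[OF indices_subset[OF assms] indices_ne[OF assms]]
    by (rule continuous_on_compose2) (auto intro!: continuous_intros)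
  then have "continuous_on UNIV (horo L p)"
    unfolding horo_def[abs_def] by (intro continuous_intros)
  then show ?thesis by (simp add: based_continuous_def horo_def)
qed

text \<open>Adding \<open>h\<close> shifts all functionals of \<open>L\<close> by the same number.
  The normalization of a horofunction cancels this shift, so \<open>horo L\<close> factors through
  the quotient.\<close>

lemma nu_add_eq_subspace:
  assumes "L \<in> indices" "h \<in> eq_subspace \<xi> L" "l \<in> L"
  shows "nu \<xi> L (x + h) = nu \<xi> L x + \<xi> l h"
proof -
  have fin: "finite L" using assms indices_finite by blast
  have eq: "\<xi> k (x + h) = \<xi> k x + \<xi> l h" if "k \<in> L" for k
  proof -
    have "\<xi> k h = \<xi> l h" using assms(2,3) that unfolding eq_subspace_def by blast
    then show ?thesis using that indices_subset[OF assms(1)] by (simp add: \<xi>_simps subset_iff)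
  qed
  obtain k where k: "k \<in> L" "nu \<xi> L x = \<xi> k x" using fin assms nu_attained by (metis empty_iff)
  show ?thesis
    using k eq nu_ge[OF fin, of _ \<xi> x] by (intro nu_eqI[OF fin, of k]) auto
qed

lemma horo_add_eq_subspace:
  assumes "L \<in> indices" "h \<in> eq_subspace \<xi> L"
  shows "horo L (p + h) = horo L p"
proof
  fix v
  obtain l where "l \<in> L" using indices_ne[OF assms(1)] by blast
  then show "horo L (p + h) v = horo L p v"
    using nu_add_eq_subspace[OF assms, of l "p - v"] nu_add_eq_subspace[OF assms, of l p]
    by (simp add: horo_def algebra_simps)
qed

lemma horo_translate_horo: "horo_translate w (horo L p) = horo L (w + p)"
  by (simp add: fun_eq_iff horo_translate_def horo_def algebra_simps)

lemma range_horo: "range (\<lambda>p u. delta \<xi> K p u - delta \<xi> K p 0) = range (horo K)"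
  by (simp add: delta_def horo_def[abs_def])

lemma bordification_eq: "bordification \<xi> K = bounded_convergence_topology closure_of range (horo K)"
  by (simp add: bordification_def range_horo)

lemma horo_in_bordification:
  assumes L: "L \<in> indices"
  shows "horo L p \<in> bordification \<xi> K"
proof (cases "L = K")
  case True
  have "range (horo K) \<subseteq> bordification \<xi> K"
    unfolding bordification_eq
    using horo_based_continuous[of K] by (intro closure_of_subset) (auto simp: indices_def)
  then show ?thesis using True by auto
next
  case False
  then obtain v where v: "nu \<xi> K v = 1" "L = {k \<in> K. \<xi> k v = 1}"
    using L by (auto simp: indices_def dual_faces_def)
  obtain C where C: "C > 0" "\<And>k x. k \<in> K \<Longrightarrow> \<bar>\<xi> k x\<bar> \<le> C * norm x" using \<xi>_bound by blast
  have less: "\<xi> k v < 1" if "k \<in> K - L" for k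
    using that nu_ge[OF finite_K, of k \<xi> v] v by force
  have LK: "L \<subseteq> K" "L \<noteq> {}" using L indices_subset indices_ne by auto
  show ?thesis
    unfolding bordification_eq in_closure_of
  proof (intro conjI allI impI)
    show "horo L p \<in> topspace bounded_convergence_topology"
      using horo_based_continuous[OF L] by simp
    fix T assume T: "horo L p \<in> T \<and> openin bounded_convergence_topology T"
    then obtain S d where S: "bounded S" "0 < d"
      and sub: "{g \<in> based_continuous. \<forall>x\<in>S. \<bar>g x - horo L p x\<bar> < d} \<subseteq> T"
      unfolding openin_bounded_convergence_topology by blast
    obtain b where b: "\<And>x. x \<in> S \<Longrightarrow> norm x \<le> b" using S by (auto simp: bounded_iff)
    \<comment> \<open>\<open>R\<close> bounds the lead of any functional over another at
      \<open>p - x\<close>. Moving by \<open>t *\<^sub>R v\<close> raises those in \<open>L\<close>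
      by \<open>t\<close> and the others by only \<open>t * \<xi> k v\<close>, which outweighs
      \<open>R\<close>. The absolute value of \<open>b\<close> ensures that \<open>x = 0\<close> is
      covered as well.\<close>
    define R where "R = 2 * C * (norm p + \<bar>b\<bar>)"
    have "\<forall>\<^sub>F t in at_top. \<forall>k\<in>K - L. R \<le> t * (1 - \<xi> k v)"
      using finite_K less by (intro eventually_ball_finite ballI eventually_le_mult_at_top) auto
    then obtain t :: real where t: "\<And>k. k \<in> K - L \<Longrightarrow> R \<le> t * (1 - \<xi> k v)"
      by (auto simp: eventually_at_top_linorder)
    define q where "q = p + t *\<^sub>R v"
    have eqL: "nu \<xi> K (q - x) = nu \<xi> L (p - x) + t" if x: "norm x \<le> \<bar>b\<bar>" for x
    proof -
      have pv: "t *\<^sub>R v \<in> eq_subspace \<xi> L"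
        using v by (auto simp: eq_subspace_def \<xi>_simps)
      obtain l0 where l0: "l0 \<in> L" using LK by blast
      have "nu \<xi> K (q - x) = nu \<xi> L (q - x)"
      proof (rule nu_restrict[OF finite_K LK])
        fix k l assume k: "k \<in> K - L" and l: "l \<in> L"
        have nx: "C * norm (p - x) \<le> C * (norm p + \<bar>b\<bar>)"
          using x C(1) norm_triangle_ineq4[of p x] by (intro mult_left_mono) auto
        have "\<xi> k (p - x) - \<xi> l (p - x) \<le> R"
          using C(2)[of k "p - x"] C(2)[of l "p - x"] k l LK nx by (auto simp: R_def)
        then show "\<xi> k (q - x) \<le> \<xi> l (q - x)"
          using t[OF k] k l v by (auto simp: q_def \<xi>_simps algebra_simps)
      qed
      also have "\<dots> = nu \<xi> L ((p - x) + t *\<^sub>R v)" by (simp add: q_def algebra_simps)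
      also have "\<dots> = nu \<xi> L (p - x) + \<xi> l0 (t *\<^sub>R v)"
        by (rule nu_add_eq_subspace[OF L pv l0])
      finally show ?thesis using l0 v by (simp add: \<xi>_simps)
    qed
    \<comment> \<open>The shift \<open>t\<close> appears at \<open>x\<close> and at \<open>0\<close>
      and cancels, so the two functions coincide exactly on \<open>S\<close>.\<close>
    have "horo K q x = horo L p x" if "x \<in> S" for x
      using eqL[of x] eqL[of 0] b[OF that] by (auto simp: horo_def)
    then have "horo K q \<in> T"
      using sub S horo_based_continuous[of K q] by (force simp: indices_def)
    then show "\<exists>y. y \<in> range (horo K) \<and> y \<in> T" by blast
  qed
qed

section \<open>Distance to the subspace where the functionals of \<open>L\<close> agree\<close>

lemma subspace_eq_subspace:
  assumes "L \<subseteq> K"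
  shows "subspace (eq_subspace \<xi> L)"
proof -
  have "eq_subspace \<xi> L = (\<Inter>k\<in>L. \<Inter>l\<in>L. {u. \<xi> k u - \<xi> l u = 0})"
    by (simp add: eq_subspace_def set_eq_iff)
  moreover have "subspace {u. \<xi> k u - \<xi> l u = 0}" if "k \<in> L" "l \<in> L" for k l
  proof -
    have "k \<in> K" "l \<in> K" using that assms by auto
    then show ?thesis by (intro linear_subspace_kernel linear_compose_sub lin)
  qed
  ultimately show ?thesis by (auto intro!: subspace_Inter)
qed

text \<open>The differences \<open>\<xi> l - \<xi> k\<close> with \<open>k, l \<in> L\<close> vanish jointly only on \<open>H\<^sub>L\<close>, hence they
  control the norm on its orthogonal complement, by compactness of the unit sphere.\<close>
lemma distance_eq_subspace_bound:
  assumes L: "L \<subseteq> K" "L \<noteq> {}"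
  shows "\<exists>C>0. \<forall>x d. (\<forall>k\<in>L. \<forall>l\<in>L. \<bar>\<xi> l x - \<xi> k x\<bar> \<le> d) \<longrightarrow>
    (\<exists>h\<in>eq_subspace \<xi> L. norm (x - h) \<le> C * d)"
proof -
  obtain l0 where l0: "l0 \<in> L" using L by blast
  have fin: "finite L" using L finite_K finite_subset by blast
  let ?H = "eq_subspace \<xi> L"
  have H: "subspace ?H" using subspace_eq_subspace L by blast
  define P where "P = {y. \<forall>h\<in>?H. orthogonal h y}"
  have P: "subspace P" unfolding P_def by (rule subspace_orthogonal_to_vectors)
  \<comment> \<open>A seminorm with kernel \<open>eq_subspace \<xi> L\<close>, hence a norm on the
    complement \<open>P\<close>. Comparing with one fixed index \<open>l0\<close> is enough to
    detect the kernel.\<close>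
  define N where "N = (\<lambda>y. \<Sum>l\<in>L. \<bar>\<xi> l y - \<xi> l0 y\<bar>)"
  have N_pos: "N y > 0" if y: "y \<in> P" "y \<noteq> 0" for y
  proof (rule ccontr)
    assume "\<not> N y > 0"
    moreover have "N y \<ge> 0" by (simp add: N_def sum_nonneg)
    ultimately have "N y = 0" by simp
    then have "\<forall>l\<in>L. \<xi> l y = \<xi> l0 y"
      using fin by (simp add: N_def sum_nonneg_eq_0_iff)
    then have "y \<in> ?H" by (simp add: eq_subspace_def)
    then show False using y by (auto simp: P_def orthogonal_self)
  qed
  have cont: "continuous_on UNIV N"
    unfolding N_def using L l0
    by (intro continuous_intros linear_continuous_on linear_conv_bounded_linear[THEN iffD1] lin) auto
  have "\<exists>c>0. \<forall>y\<in>sphere 0 1 \<inter> P. c \<le> N y"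
  proof (cases "sphere 0 1 \<inter> P = {}")
    case False
    have "compact (sphere 0 1 \<inter> P)" by (intro compact_Int_closed closed_subspace P) auto
    then obtain z where z: "z \<in> sphere 0 1 \<inter> P" "\<forall>y\<in>sphere 0 1 \<inter> P. N z \<le> N y"
      using continuous_attains_inf[OF _ False] cont continuous_on_subset by blast
    have "z \<noteq> 0" using z by auto
    then show ?thesis using z N_pos[of z] by blast
  \<comment> \<open>If \<open>P\<close> is trivial, the sphere in it is empty and any positive
    constant works.\<close>
  qed (auto intro: exI[of _ 1])
  then obtain c where c: "c > 0" "\<And>y. norm y = 1 \<Longrightarrow> y \<in> P \<Longrightarrow> c \<le> N y" by auto
  have N_scale: "N (t *\<^sub>R y) = t * N y" if "t \<ge> 0" for t y
  proof -
    have "\<bar>\<xi> l (t *\<^sub>R y) - \<xi> l0 (t *\<^sub>R y)\<bar> = t * \<bar>\<xi> l y - \<xi> l0 y\<bar>" if "l \<in> L" for l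
      using that L l0 \<open>t \<ge> 0\<close>
      by (auto simp: \<xi>_simps subset_iff abs_mult right_diff_distrib[symmetric])
    then show ?thesis by (simp add: N_def sum_distrib_left)
  qed
  have N_ge: "c * norm y \<le> N y" if "y \<in> P" for y
  proof (cases "y = 0")
    case False
    have "c \<le> N ((1 / norm y) *\<^sub>R y)" using that False P by (intro c) (auto simp: subspace_scale)
    also have "\<dots> = N y / norm y" by (subst N_scale) auto
    finally show ?thesis using False by (simp add: field_simps)
  qed (auto simp: N_def sum_nonneg)
  have "\<exists>h\<in>?H. norm (x - h) \<le> (card L / c) * d"
    if d: "\<forall>k\<in>L. \<forall>l\<in>L. \<bar>\<xi> l x - \<xi> k x\<bar> \<le> d" for x d
  proof -
    obtain h y where h: "h \<in> span ?H" "\<And>w. w \<in> span ?H \<Longrightarrow> orthogonal y w" "x = h + y"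
      using orthogonal_subspace_decomp_exists[of ?H x] by metis
    have sp: "span ?H = ?H" using H by (rule span_eq_iff[THEN iffD2])
    then have hH: "h \<in> ?H" and yP: "y \<in> P" using h unfolding sp by (auto simp: P_def orthogonal_commute)
    have "\<bar>\<xi> l y - \<xi> l0 y\<bar> \<le> d" if "l \<in> L" for l
    proof -
      have "\<xi> l h = \<xi> l0 h" using hH that l0 unfolding eq_subspace_def by blast
      then show ?thesis using d[rule_format, OF l0 that] h(3) that l0 L by (auto simp: \<xi>_simps subset_iff)
    qed
    then have "N y \<le> card L * d" unfolding N_def by (rule sum_bounded_above)
    then have "norm y \<le> (card L / c) * d" using N_ge[OF yP] c(1) by (simp add: field_simps)
    then show ?thesis using hH h(3) by (intro bexI[of _ h]) auto
  qed
  moreover have "card L / c > 0" using c fin L by (simp add: card_gt_0_iff)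
  ultimately show ?thesis by blast
qed

section \<open>Limits of horofunctions\<close>

lemma horo_convergent_subseq:
  fixes p :: "nat \<Rightarrow> 'a"
  obtains r L y where "strict_mono (r::nat \<Rightarrow> nat)" "L \<in> indices"
    "\<And>u. (\<lambda>n. horo K (p (r n)) u) \<longlonglongrightarrow> horo L y u"
proof -
  define X where "X j n = ereal (\<xi> j (p n) - nu \<xi> K (p n))" for j n
  obtain r a where r: "strict_mono (r::nat \<Rightarrow> nat)" "\<And>j. j \<in> K \<Longrightarrow> (\<lambda>n. X j (r n)) \<longlonglongrightarrow> a j"
    using finite_simultaneous_convergent_subseq[OF finite_K, of X] by metis
  have X_le: "X j n \<le> 0" if "j \<in> K" for j n
    using nu_ge[OF finite_K that, of \<xi> "p n"] by (simp add: X_def)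
  have a_le: "a j \<le> 0" if "j \<in> K" for j
    using r(2)[OF that] X_le[OF that] by (intro LIMSEQ_le_const2) auto
  define L where "L = {j \<in> K. a j \<noteq> -\<infinity>}"
  have LK: "L \<subseteq> K" by (auto simp: L_def)
  have tend_bot: "\<forall>\<^sub>F n in sequentially. \<xi> k (p (r n)) - nu \<xi> K (p (r n)) < R" if "k \<in> K - L" for k R
  proof -
    have "(\<lambda>n. X k (r n)) \<longlonglongrightarrow> -\<infinity>" using r(2)[of k] that by (auto simp: L_def)
    then have "\<forall>\<^sub>F n in sequentially. X k (r n) < ereal R" by (simp add: tendsto_MInfty)
    then show ?thesis by (simp add: X_def)
  qed
  \<comment> \<open>At every \<open>n\<close> some index attains the maximum and has difference 0,
    so the finitely many differences cannot all become negative.\<close>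
  have Lne: "L \<noteq> {}"
  proof
    assume "L = {}"
    then have "\<forall>\<^sub>F n in sequentially. \<forall>k\<in>K. \<xi> k (p (r n)) - nu \<xi> K (p (r n)) < 0"
      using tend_bot finite_K by (intro eventually_ball_finite ballI) blast+
    then obtain n where "\<forall>k\<in>K. \<xi> k (p (r n)) - nu \<xi> K (p (r n)) < 0"
      by (auto simp: eventually_sequentially)
    moreover obtain k where "k \<in> K" "nu \<xi> K (p (r n)) = \<xi> k (p (r n))"
      using nu_attained finite_K K_ne by metis
    ultimately show False by force
  qed
  have finL: "finite L" using LK finite_K finite_subset by blast
  \<comment> \<open>For an index in \<open>L\<close> the limit is neither of the infinities, so the
    differences form a convergent, hence bounded, real sequence.\<close>
  have "\<exists>b. \<forall>n. \<bar>\<xi> j (p (r n)) - nu \<xi> K (p (r n))\<bar> \<le> b" if "j \<in> L" for j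
  proof -
    have "a j \<le> 0" "a j \<noteq> -\<infinity>" using that a_le by (auto simp: L_def)
    then obtain x where "a j = ereal x" by (cases "a j") auto
    then have "(\<lambda>n. \<xi> j (p (r n)) - nu \<xi> K (p (r n))) \<longlonglongrightarrow> x"
      using r(2)[of j] that LK by (auto simp: X_def)
    then have "Bseq (\<lambda>n. \<xi> j (p (r n)) - nu \<xi> K (p (r n)))"
      by (intro convergent_imp_Bseq) (auto simp: convergent_def)
    then show ?thesis by (auto simp: Bseq_def)
  qed
  then obtain b where b: "\<And>j n. j \<in> L \<Longrightarrow> \<bar>\<xi> j (p (r n)) - nu \<xi> K (p (r n))\<bar> \<le> b j" by metis
  define M where "M = Max (b ` L)"
  have M: "\<bar>\<xi> j (p (r n)) - nu \<xi> K (p (r n))\<bar> \<le> M" if "j \<in> L" for j n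
    unfolding M_def using that finL by (intro order_trans[OF b[OF that] Max_ge]) auto
  obtain D where D: "D > 0"
    "\<And>x d. \<forall>k\<in>L. \<forall>l\<in>L. \<bar>\<xi> l x - \<xi> k x\<bar> \<le> d \<Longrightarrow>
       \<exists>h\<in>eq_subspace \<xi> L. norm (x - h) \<le> D * d"
    using distance_eq_subspace_bound[OF LK Lne] by blast
  have "\<exists>h\<in>eq_subspace \<xi> L. norm (p (r n) - h) \<le> D * (2 * M)" for n
  proof (rule D(2), intro ballI)
    fix k l assume "k \<in> L" "l \<in> L"
    then show "\<bar>\<xi> l (p (r n)) - \<xi> k (p (r n))\<bar> \<le> 2 * M" using M[of k n] M[of l n] by linarith
  qed
  then obtain h where h: "\<And>n. h n \<in> eq_subspace \<xi> L" "\<And>n. norm (p (r n) - h n) \<le> D * (2 * M)"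
    by metis
  define b' where "b' = D * (2 * M)"
  obtain y s where y: "strict_mono (s::nat \<Rightarrow> nat)" "((\<lambda>n. p (r n) - h n) \<circ> s) \<longlonglongrightarrow> y"
  proof -
    have "bounded (range (\<lambda>n. p (r n) - h n))" using h(2) by (auto intro: boundedI)
    then show ?thesis using bounded_imp_convergent_subsequence that by blast
  qed
  obtain C where C: "C > 0" "\<And>k x. k \<in> K \<Longrightarrow> \<bar>\<xi> k x\<bar> \<le> C * norm x" using \<xi>_bound by blast
  \<comment> \<open>Functionals in \<open>L\<close> stay within \<open>M\<close> of the norm while
    the others tend to minus infinity relative to it, so the gap eventually exceeds any
    \<open>R\<close>.\<close>
  have far: "\<forall>\<^sub>F n in sequentially. \<forall>k\<in>K - L. \<forall>l\<in>L. \<xi> k (p (r n)) < \<xi> l (p (r n)) - R" for R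
  proof -
    have "\<forall>\<^sub>F n in sequentially. \<forall>k\<in>K - L. \<xi> k (p (r n)) - nu \<xi> K (p (r n)) < - M - R"
      using finite_K tend_bot by (intro eventually_ball_finite) auto
    then show ?thesis
    proof eventually_elim
      case (elim n)
      show ?case
      proof (intro ballI)
        fix k l assume "k \<in> K - L" "l \<in> L"
        then show "\<xi> k (p (r n)) < \<xi> l (p (r n)) - R" using elim[rule_format, of k] M[of l n] by argo
      qed
    qed
  qed
  have "L \<in> dual_faces \<xi> K" if "L \<noteq> K"
  proof -
    \<comment> \<open>Replacing \<open>p (r n)\<close> by \<open>h n\<close> changes each functional
      by at most \<open>C * b'\<close>, so a gap of \<open>2 * C * b'\<close> remains
      strict.\<close>
    obtain n where n: "\<forall>k\<in>K - L. \<forall>l\<in>L. \<xi> k (p (r n)) < \<xi> l (p (r n)) - 2 * C * b'"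
      using far[of "2 * C * b'"] by (auto simp: eventually_sequentially)
    obtain l0 where l0: "l0 \<in> L" using Lne by blast
    show ?thesis
    proof (rule dual_faceI[OF LK Lne that])
      show "\<xi> l (h n) = \<xi> l0 (h n)" if "l \<in> L" for l
        using h(1)[of n] that l0 unfolding eq_subspace_def by blast
      fix k assume k: "k \<in> K - L"
      have "C * norm (p (r n) - h n) \<le> C * b'"
        using h(2)[of n] C(1) by (intro mult_left_mono) (auto simp: b'_def)
      then have "\<bar>\<xi> k (p (r n) - h n)\<bar> \<le> C * b'" "\<bar>\<xi> l0 (p (r n) - h n)\<bar> \<le> C * b'"
        using C(2)[of k "p (r n) - h n"] C(2)[of l0 "p (r n) - h n"] k l0 LK by auto
      then show "\<xi> k (h n) < \<xi> l0 (h n)"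
        using n[rule_format, OF k l0] k l0 LK by (auto simp: \<xi>_simps subset_iff abs_le_iff)
    qed
  qed
  then have ind: "L \<in> indices" by (auto simp: indices_def)
  have "(\<lambda>n. horo K (p ((r \<circ> s) n)) u) \<longlonglongrightarrow> horo L y u" for u
  proof -
    let ?y = "\<lambda>n. p (r n) - h n"
    have ev: "\<forall>\<^sub>F n in sequentially. nu \<xi> K (p (r n) - x) = nu \<xi> L (p (r n) - x)" for x
      using far[of "2 * (C * norm x)"]
    proof eventually_elim
      case (elim n)
      show ?case
      proof (rule nu_restrict[OF finite_K LK Lne])
        fix k l assume k: "k \<in> K - L" and l: "l \<in> L"
        then show "\<xi> k (p (r n) - x) \<le> \<xi> l (p (r n) - x)"
          using elim[rule_format, OF k l] C(2)[of k x] C(2)[of l x] LK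
          by (auto simp: \<xi>_simps subset_iff abs_le_iff)
      qed
    qed
    \<comment> \<open>Two reductions are combined: \<open>K\<close> becomes \<open>L\<close> at both
      \<open>u\<close> and the base point, and \<open>p (r n)\<close> becomes \<open>?y n\<close>
      because they differ by an element of \<open>eq_subspace \<xi> L\<close>.\<close>
    have "\<forall>\<^sub>F n in sequentially. horo L (?y n) u = horo K (p (r n)) u"
      using ev[of u] ev[of 0]
    proof eventually_elim
      case (elim n)
      have "horo L (?y n) u = horo L (p (r n)) u"
        using horo_add_eq_subspace[OF ind h(1)[of n], of "?y n"] by simp
      then show ?case using elim by (simp add: horo_def)
    qed
    then have ev2: "\<forall>\<^sub>F n in sequentially. horo L (?y (s n)) u = horo K (p (r (s n))) u"
      by (rule eventually_subseq[OF y(1)])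
    have c: "isCont (nu \<xi> L) x" for x
      using continuous_nu[OF LK Lne] by (simp add: continuous_on_eq_continuous_at)
    have "(\<lambda>n. horo L (?y (s n)) u) \<longlonglongrightarrow> horo L y u"
      unfolding horo_def using y(2)
      by (auto intro!: tendsto_intros isCont_tendsto_compose[OF c] simp: o_def)
    from Lim_transform_eventually[OF this ev2] show ?thesis by simp
  qed
  then show ?thesis using that[of "r \<circ> s" L y] strict_mono_o[OF r(1) y(1)] ind by auto
qed

text \<open>Balls of radius \<open>n\<close> with tolerance \<open>1 / Suc n\<close> turn a point of
  the closure into the limit of a sequence. The pointwise limit along a subsequence is a
  horofunction of some stratum, and limits are unique.\<close>

lemma bordification_cases:
  assumes "\<phi> \<in> bordification \<xi> K"
  obtains L p where "L \<in> indices" "\<phi> = horo L p"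
proof -
  have bc: "\<phi> \<in> based_continuous"
    using assms by (auto simp: bordification_eq in_closure_of)
  have "\<exists>p. \<forall>x\<in>ball 0 (real n). \<bar>horo K p x - \<phi> x\<bar> < 1 / Suc n" for n
  proof -
    obtain T where T: "openin bounded_convergence_topology T" "\<phi> \<in> T"
      "\<And>g x. g \<in> T \<Longrightarrow> x \<in> ball 0 (real n) \<Longrightarrow> \<bar>g x - \<phi> x\<bar> < 1 / Suc n"
      using bounded_convergence_nbhd[OF bc, of "ball 0 (real n)" "1 / Suc n"] by (auto simp del: mem_ball_0)
    then obtain p where "horo K p \<in> T" using assms by (auto simp: bordification_eq in_closure_of)
    then show ?thesis using T(3) by blast
  qed
  then obtain p where "\<And>n. \<forall>x\<in>ball 0 (real n). \<bar>horo K (p n) x - \<phi> x\<bar> < 1 / Suc n"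
    by metis
  then have p: "\<bar>horo K (p n) x - \<phi> x\<bar> < 1 / Suc n" if "norm x < real n" for n x
    using that by simp
  have lim: "(\<lambda>n. horo K (p n) x) \<longlonglongrightarrow> \<phi> x" for x
  proof (rule LIM_zero_cancel, rule tendsto_rabs_zero_cancel, rule tendsto_sandwich[OF _ _ tendsto_const])
    show "(\<lambda>n. 1 / real (Suc n)) \<longlonglongrightarrow> 0" by (rule LIMSEQ_Suc[OF lim_1_over_n])
    obtain N where N: "norm x < real N" using reals_Archimedean2 by blast
    show "\<forall>\<^sub>F n in sequentially. \<bar>horo K (p n) x - \<phi> x\<bar> \<le> 1 / real (Suc n)"
      using eventually_ge_at_top[of N]
    proof eventually_elim
      case (elim n)
      then show ?case using p[of x n] N by linarith
    qed
  qed simp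
  obtain r L y where r: "strict_mono (r::nat \<Rightarrow> nat)" "L \<in> indices"
    "\<And>u. (\<lambda>n. horo K (p (r n)) u) \<longlonglongrightarrow> horo L y u"
    using horo_convergent_subseq by blast
  have "\<phi> u = horo L y u" for u
    using LIMSEQ_unique[OF LIMSEQ_subseq_LIMSEQ[OF lim r(1), unfolded o_def] r(3)] .
  then show ?thesis using that[of L y] r(2) by blast
qed

section \<open>Recovering the stratum from a horofunction\<close>

lemma exposed_gap:
  obtains t :: real where "\<And>j k. j \<in> K \<Longrightarrow> k \<in> K - {j} \<Longrightarrow> M \<le> t * (1 - \<xi> k (e j))"
proof -
  have "\<forall>\<^sub>F t in at_top. \<forall>j\<in>K. \<forall>k\<in>K - {j}. M \<le> t * (1 - \<xi> k (e j))"
    using finite_K exposed_less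
    by (intro eventually_ball_finite ballI eventually_le_mult_at_top) auto
  then show ?thesis using that by (auto simp: eventually_at_top_linorder)
qed

text \<open>Moving towards \<open>- e j\<close> singles out the \<open>j\<close>-th affine piece of a horofunction, if there is one.\<close>
lemma horo_exposed:
  assumes L: "L \<in> indices" and j: "j \<in> K"
    and t: "\<And>k. k \<in> K - {j} \<Longrightarrow> M \<le> t * (1 - \<xi> k (e j))"
    and big: "- M < horo L p (- t *\<^sub>R e j) - t"
  shows "j \<in> L" "horo L p (- t *\<^sub>R e j) - t = \<xi> j p - nu \<xi> L p"
proof -
  have fin: "finite L" using L indices_finite by blast
  obtain k where k: "k \<in> L" "nu \<xi> L (p - - t *\<^sub>R e j) = \<xi> k (p - - t *\<^sub>R e j)"
    using nu_attained[OF fin indices_ne[OF L]] by metis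
  have kK: "k \<in> K" using k indices_subset[OF L] by blast
  \<comment> \<open>If the maximum were attained at some \<open>k\<close> other than
    \<open>j\<close>, the last term would push this value to \<open>- M\<close> or below.\<close>
  have val: "horo L p (- t *\<^sub>R e j) - t = \<xi> k p - nu \<xi> L p - t * (1 - \<xi> k (e j))"
    using k kK by (simp add: horo_def \<xi>_simps algebra_simps)
  have "k = j"
  proof (rule ccontr)
    assume "k \<noteq> j"
    then show False using t[of k] kK val big nu_ge[OF fin k(1), of \<xi> p] by auto
  qed
  then show "j \<in> L" "horo L p (- t *\<^sub>R e j) - t = \<xi> j p - nu \<xi> L p"
    using k val exposed[OF j] by auto
qed

text \<open>The \<open>j\<close>-th piece bounds the maximum from below for every \<open>t\<close>.
  This verifies the threshold in \<open>horo_exposed\<close> for indices in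
  \<open>L\<close>.\<close>

lemma horo_exposed_ge:
  assumes L: "L \<in> indices" and j: "j \<in> L"
  shows "\<xi> j p - nu \<xi> L p \<le> horo L p (- t *\<^sub>R e j) - t"
proof -
  have "j \<in> K" using assms indices_subset by blast
  then show ?thesis
    using nu_ge[OF indices_finite[OF L] j, of \<xi> "p - - t *\<^sub>R e j"] exposed
    by (simp add: horo_def \<xi>_simps)
qed

lemma horo_eqD:
  assumes L: "L \<in> indices" "L' \<in> indices" and eq: "horo L p = horo L' p'" and j: "j \<in> L"
  shows "j \<in> L'" "\<xi> j p - nu \<xi> L p = \<xi> j p' - nu \<xi> L' p'"
proof -
  have jK: "j \<in> K" using j L indices_subset by blast
  \<comment> \<open>This puts \<open>- M\<close> exactly one below the lower bound of
    \<open>horo_exposed_ge\<close>. The resulting \<open>t\<close> depends on neither index set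
    beyond that, so both horofunctions can be tested at the same point.\<close>
  define M where "M = 1 - (\<xi> j p - nu \<xi> L p)"
  obtain t where t: "\<And>k. k \<in> K - {j} \<Longrightarrow> M \<le> t * (1 - \<xi> k (e j))"
    using exposed_gap jK by metis
  have "- M < horo L p (- t *\<^sub>R e j) - t"
    using horo_exposed_ge[OF L(1) j, of p t] by (simp add: M_def)
  then show "j \<in> L'" "\<xi> j p - nu \<xi> L p = \<xi> j p' - nu \<xi> L' p'"
    using horo_exposed[OF L(1) jK t, of p] horo_exposed[OF L(2) jK t, of p'] eq by auto
qed

lemma horo_eq_iff:
  assumes L: "L \<in> indices" "L' \<in> indices"
  shows "horo L p = horo L' p' \<longleftrightarrow> L = L' \<and> p' - p \<in> eq_subspace \<xi> L"
proof
  assume eq: "horo L p = horo L' p'"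
  have "L = L'"
    using horo_eqD(1)[OF L eq] horo_eqD(1)[OF L(2,1) eq[symmetric]] by blast
  \<comment> \<open>The right-hand side does not depend on \<open>j\<close>, which is precisely
    membership in \<open>eq_subspace \<xi> L\<close>.\<close>
  moreover have "\<xi> j (p' - p) = nu \<xi> L' p' - nu \<xi> L p" if "j \<in> L" for j
    using horo_eqD(2)[OF L eq that] that indices_subset[OF L(1)] by (auto simp: \<xi>_simps subset_iff)
  ultimately show "L = L' \<and> p' - p \<in> eq_subspace \<xi> L" by (auto simp: eq_subspace_def)
next
  assume "L = L' \<and> p' - p \<in> eq_subspace \<xi> L"
  then show "horo L p = horo L' p'" using horo_add_eq_subspace[OF L(1), of "p' - p" p] by auto
qed

section \<open>Each stratum embeds into the bordification\<close>

lemma continuous_map_horo: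
  assumes L: "L \<in> indices"
  shows "continuous_map euclidean (bordification_topology \<xi> K) (horo L)"
  unfolding bordification_topology_def continuous_map_in_subtopology
proof
  show "horo L \<in> topspace euclidean \<rightarrow> bordification \<xi> K"
    using horo_in_bordification[OF L] by auto
  obtain C where C: "C > 0" "\<And>k x. k \<in> K \<Longrightarrow> \<bar>\<xi> k x\<bar> \<le> C * norm x" using \<xi>_bound by blast
  \<comment> \<open>The bound is independent of \<open>x\<close>, so nearby parameters give
    functions that are uniformly close on all of the space.\<close>
  have lip: "\<bar>horo L q x - horo L p x\<bar> \<le> 2 * C * norm (q - p)" for p q x
    using nu_lipschitz[OF C(2) indices_subset[OF L] indices_ne[OF L], of "q - x" "p - x"]
      nu_lipschitz[OF C(2) indices_subset[OF L] indices_ne[OF L], of q p]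
    by (simp add: horo_def)
  show "continuous_map euclidean bounded_convergence_topology (horo L)"
    unfolding continuous_map_def
  proof (intro conjI allI impI)
    show "horo L \<in> topspace euclidean \<rightarrow> topspace bounded_convergence_topology"
      using horo_based_continuous[OF L] by auto
    fix U :: "('a \<Rightarrow> real) set" assume U: "openin bounded_convergence_topology U"
    have "\<exists>d>0. \<forall>q. dist q p < d \<longrightarrow> horo L q \<in> U" if pU: "horo L p \<in> U" for p
    proof -
      obtain S c where c: "0 < c" "{g \<in> based_continuous. \<forall>x\<in>S. \<bar>g x - horo L p x\<bar> < c} \<subseteq> U"
        using U pU unfolding openin_bounded_convergence_topology by blast
      have "horo L q \<in> U" if "dist q p < c / (2 * C)" for q
      proof -
        have "2 * C * norm (q - p) < c" using that C(1) by (simp add: dist_norm field_simps)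
        then have "\<bar>horo L q x - horo L p x\<bar> < c" for x using lip[of q x p] by linarith
        then show ?thesis using c(2) horo_based_continuous[OF L] by auto
      qed
      then show ?thesis using c(1) C(1) by (intro exI[of _ "c / (2 * C)"]) auto
    qed
    then show "openin euclidean {x \<in> topspace euclidean. horo L x \<in> U}"
      by (auto simp: open_dist)
  qed
qed

text \<open>Near \<open>horo L p\<close>, the finitely many values at
  \<open>- t *\<^sub>R e j\<close> with \<open>j\<close> in \<open>L\<close> control the parameter
  modulo \<open>eq_subspace \<xi> L\<close>; saturation of \<open>W\<close> absorbs the
  rest.\<close>

lemma horo_image_open:
  assumes L: "L \<in> indices" and W: "open W"
    and sat: "\<And>p h. p \<in> W \<Longrightarrow> h \<in> eq_subspace \<xi> L \<Longrightarrow> p + h \<in> W"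
  shows "openin (subtopology (bordification_topology \<xi> K) (range (horo L))) (horo L ` W)"
proof (subst openin_subopen, intro ballI)
  fix \<phi> assume "\<phi> \<in> horo L ` W"
  then obtain p where p: "p \<in> W" "\<phi> = horo L p" by blast
  have LK: "L \<subseteq> K" "L \<noteq> {}" "finite L" using L indices_subset indices_ne indices_finite by auto
  obtain D where D: "D > 0"
    "\<And>x d. \<forall>k\<in>L. \<forall>l\<in>L. \<bar>\<xi> l x - \<xi> k x\<bar> \<le> d \<Longrightarrow>
       \<exists>h\<in>eq_subspace \<xi> L. norm (x - h) \<le> D * d"
    using distance_eq_subspace_bound[OF LK(1,2)] by blast
  obtain d where d: "d > 0" "\<And>q. dist q p < d \<Longrightarrow> q \<in> W" using W p by (auto simp: open_dist)
  \<comment> \<open>An error \<open>c\<close> in each offset gives \<open>2 * c\<close> in the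
    differences of functionals, hence distance at most \<open>D * (2 * c) = d / 2\<close>.\<close>
  define c where "c = d / (4 * D)"
  have c: "c > 0" using d D by (simp add: c_def)
  \<comment> \<open>The summand \<open>c\<close> keeps the values of every horofunction within
    \<open>c\<close> of the given one above \<open>- M\<close>, so \<open>horo_exposed\<close>
    applies to both.\<close>
  define M where "M = Max ((\<lambda>j. nu \<xi> L p - \<xi> j p) ` L) + c + 1"
  have M: "\<xi> j p - nu \<xi> L p - c > - M" if "j \<in> L" for j
  proof -
    have "nu \<xi> L p - \<xi> j p \<le> Max ((\<lambda>j. nu \<xi> L p - \<xi> j p) ` L)"
      using that LK(3) by (intro Max_ge) auto
    then show ?thesis by (simp add: M_def)
  qed
  obtain t where t: "\<And>j k. j \<in> K \<Longrightarrow> k \<in> K - {j} \<Longrightarrow> M \<le> t * (1 - \<xi> k (e j))"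
    using exposed_gap by metis
  obtain T where T: "openin bounded_convergence_topology T" "\<phi> \<in> T"
    "\<And>g x. g \<in> T \<Longrightarrow> x \<in> (\<lambda>j. - t *\<^sub>R e j) ` L \<Longrightarrow> \<bar>g x - \<phi> x\<bar> < c"
    using bounded_convergence_nbhd[OF horo_based_continuous[OF L, of p], of "(\<lambda>j. - t *\<^sub>R e j) ` L" c]
      LK(3) c p(2) by (metis finite_imageI finite_imp_bounded)
  have near: "horo L q \<in> horo L ` W" if q: "horo L q \<in> T" for q
  proof -
    have close: "\<bar>(\<xi> j q - nu \<xi> L q) - (\<xi> j p - nu \<xi> L p)\<bar> < c" if j: "j \<in> L" for j
    proof -
      have jK: "j \<in> K" using j LK by blast
      have v: "\<bar>horo L q (- t *\<^sub>R e j) - horo L p (- t *\<^sub>R e j)\<bar> < c"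
        using T(3)[OF q] j p(2) by blast
      have ge: "\<xi> j p - nu \<xi> L p \<le> horo L p (- t *\<^sub>R e j) - t" by (rule horo_exposed_ge[OF L j])
      have "horo L p (- t *\<^sub>R e j) - t = \<xi> j p - nu \<xi> L p"
        using M[OF j] ge c by (intro horo_exposed[OF L jK t[OF jK]]) auto
      moreover have "horo L q (- t *\<^sub>R e j) - t = \<xi> j q - nu \<xi> L q"
        using M[OF j] ge v by (intro horo_exposed[OF L jK t[OF jK]]) auto
      ultimately show ?thesis using v by argo
    qed
    have "\<exists>h\<in>eq_subspace \<xi> L. norm ((q - p) - h) \<le> D * (2 * c)"
    proof (rule D(2), intro ballI)
      fix k l assume "k \<in> L" "l \<in> L"
      then show "\<bar>\<xi> l (q - p) - \<xi> k (q - p)\<bar> \<le> 2 * c"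
        using close[of k] close[of l] LK(1) by (auto simp: \<xi>_simps subset_iff)
    qed
    then obtain h where h: "h \<in> eq_subspace \<xi> L" "norm ((q - p) - h) \<le> D * (2 * c)" by blast
    have "D * (2 * c) < d" using d D by (simp add: c_def)
    then have "q - h \<in> W" using h by (intro d) (simp add: dist_norm algebra_simps)
    then have "q \<in> W" using sat[OF _ h(1), of "q - h"] by simp
    then show ?thesis by blast
  qed
  let ?T = "T \<inter> range (horo L)"
  have "range (horo L) \<subseteq> bordification \<xi> K" using horo_in_bordification[OF L] by blast
  then have "openin (subtopology (bordification_topology \<xi> K) (range (horo L))) ?T"
    using T(1) unfolding bordification_topology_def subtopology_subtopology
    by (auto simp: openin_subtopology Int_absorb1)
  then show "\<exists>T. openin (subtopology (bordification_topology \<xi> K) (range (horo L))) T \<and>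
      \<phi> \<in> T \<and> T \<subseteq> horo L ` W"
    using T(2) p(2) near by (intro exI[of _ ?T]) auto
qed

text \<open>Abstracting from the quotient map treats the top stratum, where it is the identity, and
  the proper quotients at once.\<close>

lemma embedding_map_horo:
  assumes L: "L \<in> indices" and q: "quotient_map euclidean X \<pi>"
    and fib: "\<And>p q. \<pi> p = \<pi> q \<longleftrightarrow> q - p \<in> eq_subspace \<xi> L"
    and F: "\<And>p. F (\<pi> p) = horo L p"
  shows "embedding_map X (bordification_topology \<xi> K) F"
proof -
  have top: "topspace X = range \<pi>" using q by (simp add: quotient_map_def)
  have img: "F ` topspace X = range (horo L)" using F by (auto simp: top image_iff)
  have Fo: "F \<circ> \<pi> = horo L" using F by auto
  show ?thesis
    unfolding embedding_map_def img
  proof (rule bijective_open_imp_homeomorphic_map)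
    show "continuous_map X (subtopology (bordification_topology \<xi> K) (range (horo L))) F"
      using continuous_map_horo[OF L] img unfolding Fo[symmetric]
      by (auto simp: continuous_map_in_subtopology continuous_compose_quotient_map_eq[OF q])
    show "inj_on F (topspace X)"
      by (auto simp: top inj_on_def F fib horo_eq_iff[OF L L])
    show "F ` topspace X = topspace (subtopology (bordification_topology \<xi> K) (range (horo L)))"
      using img horo_in_bordification[OF L] horo_based_continuous[OF L]
      by (auto simp: bordification_topology_def)
    show "open_map X (subtopology (bordification_topology \<xi> K) (range (horo L))) F"
      unfolding open_map_def
    proof (intro allI impI)
      fix U assume U: "openin X U"
      define W where "W = \<pi> -` U"
      have W: "open W"
        using openin_continuous_map_preimage[OF quotient_imp_continuous_map[OF q] U]
        by (simp add: W_def vimage_def)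
      have sat: "p + h \<in> W" if "p \<in> W" "h \<in> eq_subspace \<xi> L" for p h
        using that fib[of p "p + h"] by (simp add: W_def)
      have "U = \<pi> ` W" using openin_subset[OF U] by (auto simp: W_def top)
      then have "F ` U = horo L ` W" by (simp add: image_image F)
      then show "openin (subtopology (bordification_topology \<xi> K) (range (horo L))) (F ` U)"
        using horo_image_open[OF L W sat] by simp
    qed
  qed
qed

section \<open>The bijection with the strata\<close>

lemma coset_eq_iff:
  assumes "L \<subseteq> K"
  shows "coset (eq_subspace \<xi> L) p = coset (eq_subspace \<xi> L) q \<longleftrightarrow> q - p \<in> eq_subspace \<xi> L"
proof
  have H: "subspace (eq_subspace \<xi> L)" by (rule subspace_eq_subspace[OF assms])
  {
    assume "coset (eq_subspace \<xi> L) p = coset (eq_subspace \<xi> L) q"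
    moreover have "q \<in> coset (eq_subspace \<xi> L) q"
      using subspace_0[OF H] by (force simp: coset_def)
    ultimately obtain h where "h \<in> eq_subspace \<xi> L" "q = p + h" by (auto simp: coset_def)
    then show "q - p \<in> eq_subspace \<xi> L" by simp
  }
  assume d: "q - p \<in> eq_subspace \<xi> L"
  have "x \<in> coset (eq_subspace \<xi> L) p \<longleftrightarrow> x - p \<in> eq_subspace \<xi> L" for x p
    by (force simp: coset_def image_iff)
  moreover have "x - p \<in> eq_subspace \<xi> L \<longleftrightarrow> x - q \<in> eq_subspace \<xi> L" for x
    using subspace_add[OF H _ d, of "x - q"] subspace_diff[OF H _ d, of "x - p"] by auto
  ultimately show "coset (eq_subspace \<xi> L) p = coset (eq_subspace \<xi> L) q" by blast
qed

text \<open>The inverse of the desired bijection is built first, since a point of a stratum gives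
  its horofunction directly. The chosen representative is immaterial by
  \<open>horo_eq_iff\<close>.\<close>

definition strata_map :: "'a + nat set \<times> 'a set \<Rightarrow> 'a \<Rightarrow> real" where
  "strata_map s = (case s of Inl p \<Rightarrow> horo K p
     | Inr (L, c) \<Rightarrow> horo L (SOME p. c = coset (eq_subspace \<xi> L) p))"

lemma dual_face_index: "L \<in> dual_faces \<xi> K \<Longrightarrow> L \<in> indices" and K_index: "K \<in> indices"
  by (auto simp: indices_def)

lemma strata_map_Inl: "strata_map (Inl p) = horo K p"
  by (simp add: strata_map_def)

lemma strata_map_Inr:
  assumes "L \<in> dual_faces \<xi> K"
  shows "strata_map (Inr (L, coset (eq_subspace \<xi> L) p)) = horo L p"
proof -
  let ?q = "SOME q. coset (eq_subspace \<xi> L) p = coset (eq_subspace \<xi> L) q"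
  have "coset (eq_subspace \<xi> L) p = coset (eq_subspace \<xi> L) ?q" by (rule someI) (rule refl)
  then have "horo L p = horo L ?q"
    using assms dual_face_index indices_subset horo_eq_iff coset_eq_iff by metis
  then show ?thesis by (simp add: strata_map_def)
qed

lemma strata_cases:
  assumes "s \<in> strata \<xi> K"
  obtains p where "s = Inl p"
  | L p where "L \<in> dual_faces \<xi> K" "s = Inr (L, coset (eq_subspace \<xi> L) p)"
  using assms by (auto simp: strata_def quotient_space_def)

lemma strataI:
  "Inl p \<in> strata \<xi> K"
  "L \<in> dual_faces \<xi> K \<Longrightarrow> Inr (L, coset (eq_subspace \<xi> L) p) \<in> strata \<xi> K"
  by (auto simp: strata_def quotient_space_def)

lemma bij_betw_strata_map: "bij_betw strata_map (strata \<xi> K) (bordification \<xi> K)"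
  unfolding bij_betw_def
proof
  have face: "L \<in> indices" "L \<noteq> K" "K \<noteq> L" if "L \<in> dual_faces \<xi> K" for L
    using that K_not_dual_face dual_face_index by auto
  show "inj_on strata_map (strata \<xi> K)"
  proof (rule inj_onI)
    fix s s' assume "s \<in> strata \<xi> K" "s' \<in> strata \<xi> K" "strata_map s = strata_map s'"
    then show "s = s'"
      by (elim strata_cases)
        (auto simp: strata_map_Inl strata_map_Inr horo_eq_iff face K_index eq_subspace_K
          coset_eq_iff indices_subset)
  qed
  show "strata_map ` strata \<xi> K = bordification \<xi> K"
  proof (intro equalityI subsetI)
    fix \<phi> assume "\<phi> \<in> strata_map ` strata \<xi> K"
    then show "\<phi> \<in> bordification \<xi> K"
      by (auto elim!: strata_cases simp: strata_map_Inl strata_map_Inr horo_in_bordification face K_index)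
  next
    fix \<phi> assume "\<phi> \<in> bordification \<xi> K"
    then obtain L p where L: "L \<in> indices" "\<phi> = horo L p" using bordification_cases by blast
    then consider "L = K" | "L \<in> dual_faces \<xi> K" by (auto simp: indices_def)
    then show "\<phi> \<in> strata_map ` strata \<xi> K"
      by cases (metis L(2) image_eqI strataI strata_map_Inl strata_map_Inr)+
  qed
qed

section \<open>The bijection from horofunctions to strata: formulas, equivariance,
  embeddings\<close>

definition strata_of :: "('a \<Rightarrow> real) \<Rightarrow> 'a + nat set \<times> 'a set" where
  "strata_of = inv_into (strata \<xi> K) strata_map"

lemma bij_betw_strata_of: "bij_betw strata_of (bordification \<xi> K) (strata \<xi> K)"
  unfolding strata_of_def by (rule bij_betw_inv_into[OF bij_betw_strata_map])

lemma strata_of_Inl: "strata_of (horo K p) = Inl p"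
  unfolding strata_of_def
  using bij_betw_inv_into_left[OF bij_betw_strata_map strataI(1), of p] by (simp add: strata_map_Inl)

lemma strata_of_Inr:
  assumes "L \<in> dual_faces \<xi> K"
  shows "strata_of (horo L p) = Inr (L, coset (eq_subspace \<xi> L) p)"
  unfolding strata_of_def
  using bij_betw_inv_into_left[OF bij_betw_strata_map strataI(2)[OF assms], of p] assms
  by (simp add: strata_map_Inr)

lemma inv_strata_of:
  "inv_into (bordification \<xi> K) strata_of (Inl p) = horo K p"
  "L \<in> dual_faces \<xi> K \<Longrightarrow>
    inv_into (bordification \<xi> K) strata_of (Inr (L, coset (eq_subspace \<xi> L) p)) = horo L p"
  using bij_betw_inv_into_left[OF bij_betw_strata_of horo_in_bordification[OF K_index], of p]
    bij_betw_inv_into_left[OF bij_betw_strata_of horo_in_bordification[OF dual_face_index], of L p]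
  by (simp_all add: strata_of_Inl strata_of_Inr)

lemma strata_of_equivariant:
  assumes "\<phi> \<in> bordification \<xi> K"
  shows "horo_translate w \<phi> \<in> bordification \<xi> K"
    "strata_of (horo_translate w \<phi>) = strata_translate w (strata_of \<phi>)"
proof -
  obtain L p where L: "L \<in> indices" "\<phi> = horo L p" using bordification_cases[OF assms] by blast
  then show "horo_translate w \<phi> \<in> bordification \<xi> K"
    by (simp add: horo_translate_horo horo_in_bordification)
  have "coset H (w + p) = (\<lambda>x. w + x) ` coset H p" for H
    by (auto simp: coset_def image_image add.assoc)
  then show "strata_of (horo_translate w \<phi>) = strata_translate w (strata_of \<phi>)"
    using L by (auto simp: horo_translate_horo indices_def strata_of_Inl strata_of_Inr)
qed

lemma embedding_map_top_stratum:
  "embedding_map euclidean (bordification_topology \<xi> K)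
     (\<lambda>p. inv_into (bordification \<xi> K) strata_of (Inl p))"
  by (rule embedding_map_horo[OF K_index, of _ "\<lambda>p. p"])
    (auto simp: inv_strata_of eq_subspace_K quotient_map_def)

lemma embedding_map_stratum:
  assumes "L \<in> dual_faces \<xi> K"
  shows "embedding_map (quotient_topology (eq_subspace \<xi> L)) (bordification_topology \<xi> K)
     (\<lambda>c. inv_into (bordification \<xi> K) strata_of (Inr (L, c)))"
  using assms
  by (intro embedding_map_horo[OF dual_face_index quotient_map_coset])
    (simp_all add: inv_strata_of coset_eq_iff indices_subset dual_face_index)

end

section \<open>The norm given by the facets of a polytope\<close>

text \<open>Passes from the facets of the polytope to the functionals: the unit ball lies in
  \<open>B\<close>, and each facet has a point on no other facet.\<close>

lemma facets_polyhedral_norm: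
  fixes B :: "'a::euclidean_space set"
  assumes B: "compact B" "polyhedron B" "0 \<in> interior B"
    and K: "finite K" "bij_betw A K {F. F facet_of B}"
    and lin: "\<And>j. j \<in> K \<Longrightarrow> linear (\<xi> j)"
    and A: "\<And>j. j \<in> K \<Longrightarrow> A j = {v \<in> B. \<xi> j v = 1}"
  obtains e where "polyhedral_norm \<xi> K e"
proof -
  have facet: "A j facet_of B" if "j \<in> K" for j
    using bij_betwE[OF K(2)] that by blast
  have B0: "0 \<in> B" using B interior_subset by blast
  \<comment> \<open>Otherwise the open segment from 0 to \<open>v\<close> meets \<open>A j\<close>,
    and the face property forces 0 into \<open>A j\<close>, where \<open>\<xi> j\<close> is
    1.\<close>
  have le: "\<xi> j v \<le> 1" if j: "j \<in> K" and v: "v \<in> B" for j v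
  proof (rule ccontr)
    assume "\<not> \<xi> j v \<le> 1"
    then have gt: "\<xi> j v > 1" by simp
    define t where "t = 1 / \<xi> j v"
    have t: "0 < t" "t < 1" using gt by (auto simp: t_def)
    have "t *\<^sub>R v \<in> open_segment 0 v"
      using t gt linear_0[OF lin[OF j]] by (auto simp: in_segment intro!: exI[of _ t])
    moreover have "t *\<^sub>R v \<in> A j"
    proof -
      have "t *\<^sub>R v \<in> B"
        using convexD_alt[OF polyhedron_imp_convex[OF B(2)] B0 v, of t] t by simp
      then show ?thesis using A[OF j] gt by (auto simp: linear_cmul[OF lin[OF j]] t_def)
    qed
    ultimately have "0 \<in> A j"
      using facet[OF j] B0 v by (auto simp: facet_of_def face_of_def)
    then show False using A[OF j] linear_0[OF lin[OF j]] by auto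
  qed
  \<comment> \<open>The segment from 0 to a point \<open>u\<close> outside \<open>B\<close> leaves
    \<open>B\<close> at some \<open>t *\<^sub>R u\<close> with \<open>t < 1\<close>. This exit point
    lies on a facet, so some functional would exceed 1 at \<open>u\<close>.\<close>
  have ball: "{u. \<forall>k\<in>K. \<xi> k u \<le> 1} \<subseteq> B"
  proof (intro subsetI, rule ccontr)
    fix u assume u: "u \<in> {u. \<forall>k\<in>K. \<xi> k u \<le> 1}" "u \<notin> B"
    have "closed_segment 0 u \<inter> frontier B \<noteq> {}"
      using B0 u by (intro connected_Int_frontier) auto
    then obtain x where x: "x \<in> closed_segment 0 u" "x \<in> frontier B" by blast
    then obtain t where t: "x = t *\<^sub>R u" "0 \<le> t" "t \<le> 1" by (auto simp: in_segment)
    have xB: "x \<in> B" using x B compact_imp_closed frontier_subset_closed by blast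
    have "t < 1" using t xB u by (cases "t = 1") auto
    have "rel_frontier B = frontier B"
      using B(3) by (intro rel_frontier_nonempty_interior) auto
    then have "x \<in> \<Union> (A ` K)"
      using x(2) rel_frontier_of_polyhedron[OF B(2)] bij_betw_imp_surj_on[OF K(2)] by simp
    then obtain j where j: "j \<in> K" "x \<in> A j" by blast
    then have "t * \<xi> j u = 1" using A t by (auto simp: linear_cmul[OF lin])
    moreover have "t * \<xi> j u \<le> t" using u(1) j t by (auto intro: mult_left_le)
    ultimately show False using \<open>t < 1\<close> by simp
  qed
  \<comment> \<open>A relative interior point of \<open>A j\<close> works: if it lay on
    \<open>A k\<close>, then \<open>A j\<close> would be a face of \<open>A k\<close> of the same
    dimension, so the two facets would coincide.\<close>
  have "\<exists>v. v \<in> A j \<and> (\<forall>k\<in>K - {j}. \<xi> k v < 1)" if j: "j \<in> K" for j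
  proof -
    have cA: "convex (A j)" "A j \<noteq> {}"
      using facet[OF j] face_of_imp_convex by (auto simp: facet_of_def)
    then obtain v where v: "v \<in> rel_interior (A j)" using rel_interior_eq_empty by blast
    have vA: "v \<in> A j" using v rel_interior_subset by blast
    have "\<xi> k v < 1" if k: "k \<in> K - {j}" for k
    proof (rule ccontr)
      assume "\<not> \<xi> k v < 1"
      moreover have "v \<in> B" using vA A[OF j] by auto
      ultimately have "v \<in> A k" using le[of k v] A[of k] k by force
      then have sub: "A j \<subseteq> A k"
        using facet[of k] k v A[OF j]
        by (intro subset_of_face_of[of "A k" B "A j"]) (auto simp: facet_of_def)
      then have "A j face_of A k"
        using facet[of k] facet[OF j] k by (meson DiffD1 face_of_subset facet_of_imp_face_of facet_of_imp_subset)
      moreover have "aff_dim (A j) = aff_dim (A k)" using facet[of k] facet[OF j] k by (auto simp: facet_of_def)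
      moreover have "convex (A k)" using facet[of k] k face_of_imp_convex by (auto simp: facet_of_def)
      ultimately have "A j = A k" using face_of_aff_dim_lt by fastforce
      then show False using K j k by (auto simp: bij_betw_def inj_on_def)
    qed
    then show ?thesis using vA by blast
  qed
  then obtain e where e: "\<And>j. j \<in> K \<Longrightarrow> e j \<in> A j"
    "\<And>j k. j \<in> K \<Longrightarrow> k \<in> K \<Longrightarrow> k \<noteq> j \<Longrightarrow> \<xi> k (e j) < 1"
    by (metis DiffI singletonD)
  have bdd: "bounded {u. \<forall>k\<in>K. \<xi> k u \<le> 1}" using ball B compact_imp_bounded bounded_subset by blast
  \<comment> \<open>With no functionals the bounded set would be the whole space.\<close>
  then have "K \<noteq> {}" by auto
  have "polyhedral_norm \<xi> K e"
    unfolding polyhedral_norm_def using K(1) \<open>K \<noteq> {}\<close> lin bdd e A by simp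
  then show ?thesis using that by blast
qed

theorem theorem6p17:
  fixes B :: "'a::euclidean_space set"
    and A :: "nat \<Rightarrow> 'a set"
    and \<xi> :: "nat \<Rightarrow> 'a \<Rightarrow> real"
    and m :: nat and K :: "nat set"
  assumes "compact B" and "convex B" and "polyhedron B" and "0 \<in> interior B"
    and "K = {0..m}"
    and "bij_betw A K {F. F facet_of B}"
    and "\<And>j. j \<in> K \<Longrightarrow> linear (\<xi> j)"
    and "\<And>j. j \<in> K \<Longrightarrow> A j = {v \<in> B. \<xi> j v = 1}"
  shows "\<exists>\<Phi> :: ('a \<Rightarrow> real) \<Rightarrow> 'a + nat set \<times> 'a set.
      bij_betw \<Phi> (bordification \<xi> K) (strata \<xi> K)
    \<and> (\<forall>w. \<forall>\<phi> \<in> bordification \<xi> K.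
          horo_translate w \<phi> \<in> bordification \<xi> K
        \<and> \<Phi> (horo_translate w \<phi>) = strata_translate w (\<Phi> \<phi>))
    \<and> (\<forall>p. (\<lambda>v. nu \<xi> K (p - v) - nu \<xi> K p) \<in> bordification \<xi> K
        \<and> \<Phi> (\<lambda>v. nu \<xi> K (p - v) - nu \<xi> K p) = Inl p)
    \<and> (\<forall>L \<in> dual_faces \<xi> K. \<forall>p.
          (\<lambda>v. nu \<xi> L (p - v) - nu \<xi> L p) \<in> bordification \<xi> K
        \<and> \<Phi> (\<lambda>v. nu \<xi> L (p - v) - nu \<xi> L p) = Inr (L, coset (eq_subspace \<xi> L) p))
    \<and> embedding_map euclidean (bordification_topology \<xi> K)
        (\<lambda>p. inv_into (bordification \<xi> K) \<Phi> (Inl p))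
    \<and> (\<forall>L \<in> dual_faces \<xi> K.
          embedding_map (quotient_topology (eq_subspace \<xi> L)) (bordification_topology \<xi> K)
            (\<lambda>c. inv_into (bordification \<xi> K) \<Phi> (Inr (L, c))))"
proof -
  have "finite K" using assms(5) by simp
  then obtain e where "polyhedral_norm \<xi> K e"
    using facets_polyhedral_norm[OF assms(1,3,4) _ assms(6-8)] by blast
  then interpret polyhedral_norm \<xi> K e .
  have horo_eq: "(\<lambda>v. nu \<xi> L (p - v) - nu \<xi> L p) = horo L p" for L p
    by (simp add: fun_eq_iff horo_def)
  show ?thesis
    unfolding horo_eq
    by (intro exI[of _ strata_of] conjI allI ballI bij_betw_strata_of strata_of_equivariant
        horo_in_bordification strata_of_Inl strata_of_Inr embedding_map_top_stratum
        embedding_map_stratum K_index dual_face_index)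
qed

end
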